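(* Assume that every set $G_n$ is convex, and that the Jackson-type inequality (J), the Bernstein-type inequality (B) and the realization inequality (R) stated in the context hold with some $\alpha>0$. (A) If $X$ is $\tau$-uniformly convex for some $\tau>1$, then there is a constant $C>0$ such that for all $f\in X$ and $n\in\mathbb N$ $$\Big(\sum_{k=n+1}^\infty 2^{-k\alpha\tau}\|P_{2^k}(f)\|_Y^\tau\Big)^{1/\tau}\le C\,K(f,2^{-n\alpha};X,Y).$$ (B) If $X$ is $\theta$-uniformly smooth for some $\theta>1$, then there is a constant $C>0$ such that for all $f\in X$ and $n\in\mathbb N$ $$K(f,2^{-n\alpha};X,Y)\le C\Big(\sum_{k=n+1}^\infty 2^{-k\alpha\theta}\|P_{2^k}(f)\|_Y^\theta\Big)^{1/\theta}.$$
   Context: $X$ is a Banach (function) space with norm $\|\cdot\|_X$, and $Y\subset X$ is a function space with (semi-)norm $\|\cdot\|_Y$. The $K$-functional is $K(f,t;X,Y)=\inf\{\|f-g\|_X+t\|g\|_Y: g\in Y\}$ for $f\in X$, $t>0$. $\{G_n\}_{n\ge1}$ is a family of subsets of $Y$ such that $0\in G_1$, $G_n\subset G_{n+1}$, $G_n=-G_n$, and the closure of $\bigcup_n G_n$ in $X$ is $X$. Put $E_n(f)_X=\inf\{\|f-g\|_X: g\in G_n\}$. $P_n(f)\in G_n$ denotes an element of best approximation to $f\in X$ from $G_n$ (assumed to exist), i.e. $\|f-P_n(f)\|_X=E_n(f)_X$. (J) There is $c_1>0$ with $E_n(f)_X\le c_1n^{-\alpha}\|f\|_Y$ for all $f\in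 Y$, $n\in\mathbb N$. (B) There is $c_2>0$ with $\|g_1-g_2\|_Y\le c_2n^{\alpha}\|g_1-g_2\|_X$ for all $g_1,g_2\in G_n$, $n\in\mathbb N$. (R) There is $c_3>0$ such that for all $f\in X$, $n\in\mathbb N$: $\inf\{\|f-g\|_X+n^{-\alpha}\|g\|_Y: g\in G_n\}\le c_3K(f,n^{-\alpha};X,Y)$. The moduli of convexity and smoothness of $X$ are $\delta_X(\varepsilon)=\inf\{1-\|\frac{x+y}2\|_X:\ \|x\|_X=\|y\|_X=1,\ \|x-y\|_X=\varepsilon\}$, $0\le\varepsilon\le2$, and $\rho_X(t)=\sup\{\frac12(\|x+y\|_X+\|x-y\|_X)-1:\ \|x\|_X=1,\ \|y\|_X=t\}$, $t>0$. $X$ is $\tau$-uniformly convex (resp. $\theta$-uniformly smooth) if there is $c>0$ with $\delta_X(\varepsilon)\ge c\varepsilon^\tau$ for all $\varepsilon\in[0,2]$ (resp. $\rho_X(t)\le ct^\theta$ for all $t>0$). *)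

theory Defs
  imports "HOL-Analysis.Analysis"
begin

definition seminorm_on :: "'a::real_vector set \<Rightarrow> ('a \<Rightarrow> real) \<Rightarrow> bool" where
  "seminorm_on Y N \<longleftrightarrow> subspace Y \<and> (\<forall>f\<in>Y. 0 \<le> N f) \<and>
     (\<forall>f\<in>Y. \<forall>c. N (c *\<^sub>R f) = \<bar>c\<bar> * N f) \<and>
     (\<forall>f\<in>Y. \<forall>g\<in>Y. N (f + g) \<le> N f + N g)"

definition K_functional :: "'a::real_normed_vector set \<Rightarrow> ('a \<Rightarrow> real) \<Rightarrow> 'a \<Rightarrow> real \<Rightarrow> real" where
  "K_functional Y N f t = (INF g\<in>Y. norm (f - g) + t * N g)"

definition best_approx_error :: "(nat \<Rightarrow> 'a::real_normed_vector set) \<Rightarrow> nat \<Rightarrow> 'a \<Rightarrow> real" where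
  "best_approx_error G n f = (INF g\<in>G n. norm (f - g))"

text \<open>The families \<open>G\<close> are indexed by the positive integers; the value \<open>G 0\<close> is irrelevant.\<close>

definition approx_family :: "'a::real_normed_vector set \<Rightarrow> (nat \<Rightarrow> 'a set) \<Rightarrow> bool" where
  "approx_family Y G \<longleftrightarrow> 0 \<in> G 1 \<and>
     (\<forall>n\<ge>1. G n \<subseteq> Y \<and> G n \<subseteq> G (n + 1) \<and> G n = uminus ` G n) \<and>
     closure (\<Union>n\<in>{1..}. G n) = UNIV"

definition best_approximation ::
    "(nat \<Rightarrow> 'a::real_normed_vector set) \<Rightarrow> (nat \<Rightarrow> 'a \<Rightarrow> 'a) \<Rightarrow> bool" where
  "best_approximation G P \<longleftrightarrow>
     (\<forall>n\<ge>1. \<forall>f. P n f \<in> G n \<and> norm (f - P n f) = best_approx_error G n f)"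

definition jackson_inequality ::
    "'a::real_normed_vector set \<Rightarrow> ('a \<Rightarrow> real) \<Rightarrow> (nat \<Rightarrow> 'a set) \<Rightarrow> real \<Rightarrow> bool" where
  "jackson_inequality Y N G \<alpha> \<longleftrightarrow>
     (\<exists>c>0. \<forall>f\<in>Y. \<forall>n\<ge>1. best_approx_error G n f \<le> c * real n powr (-\<alpha>) * N f)"

definition bernstein_inequality ::
    "('a::real_normed_vector \<Rightarrow> real) \<Rightarrow> (nat \<Rightarrow> 'a set) \<Rightarrow> real \<Rightarrow> bool" where
  "bernstein_inequality N G \<alpha> \<longleftrightarrow>
     (\<exists>c>0. \<forall>n\<ge>1. \<forall>g\<^sub>1\<in>G n. \<forall>g\<^sub>2\<in>G n.
        N (g\<^sub>1 - g\<^sub>2) \<le> c * real n powr \<alpha> * norm (g\<^sub>1 - g\<^sub>2))"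

definition realization_inequality ::
    "'a::real_normed_vector set \<Rightarrow> ('a \<Rightarrow> real) \<Rightarrow> (nat \<Rightarrow> 'a set) \<Rightarrow> real \<Rightarrow> bool" where
  "realization_inequality Y N G \<alpha> \<longleftrightarrow>
     (\<exists>c>0. \<forall>f. \<forall>n\<ge>1.
        (INF g\<in>G n. norm (f - g) + real n powr (-\<alpha>) * N g)
          \<le> c * K_functional Y N f (real n powr (-\<alpha>)))"

text \<open>
  The moduli are extended-real valued because the sets below can be empty, e.g. in the
  one-dimensional space for \<open>0 < \<epsilon> < 2\<close>; then the infimum is \<open>\<infinity>\<close> and the supremum \<open>-\<infinity>\<close>.
\<close>

definition modulus_of_convexity :: "'a::real_normed_vector itself \<Rightarrow> real \<Rightarrow> ereal" where
  "modulus_of_convexity (_ :: 'a itself) \<epsilon> =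
     Inf {ereal (1 - norm ((1/2) *\<^sub>R (x + y))) | x y :: 'a.
            norm x = 1 \<and> norm y = 1 \<and> norm (x - y) = \<epsilon>}"

definition modulus_of_smoothness :: "'a::real_normed_vector itself \<Rightarrow> real \<Rightarrow> ereal" where
  "modulus_of_smoothness (_ :: 'a itself) t =
     Sup {ereal ((1/2) * (norm (x + y) + norm (x - y)) - 1) | x y :: 'a.
            norm x = 1 \<and> norm y = t}"

definition uniformly_convex :: "'a::real_normed_vector itself \<Rightarrow> real \<Rightarrow> bool" where
  "uniformly_convex X \<tau> \<longleftrightarrow>
     (\<exists>c>0. \<forall>\<epsilon>\<in>{0..2}. modulus_of_convexity X \<epsilon> \<ge> ereal (c * \<epsilon> powr \<tau>))"

definition uniformly_smooth :: "'a::real_normed_vector itself \<Rightarrow> real \<Rightarrow> bool" where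
  "uniformly_smooth X \<theta> \<longleftrightarrow>
     (\<exists>c>0. \<forall>t>0. modulus_of_smoothness X t \<le> ereal (c * t powr \<theta>))"

end

theory Submission
  imports Defs
begin

text \<open>
  Write \<open>P\<^sub>k\<close> for the best approximant of \<open>f\<close> from \<open>G (2 ^ k)\<close> and \<open>E\<^sub>k\<close> for its error.

  Upper bound. The midpoint of \<open>P\<^sub>k\<close> and \<open>P\<^sub>k\<^sub>+\<^sub>1\<close> is a competitor for \<open>P\<^sub>k\<^sub>+\<^sub>1\<close>, so uniform convexity
  bounds \<open>norm (P\<^sub>k\<^sub>+\<^sub>1 - P\<^sub>k) powr \<tau>\<close> by a multiple of \<open>E\<^sub>k powr \<tau> - E\<^sub>k\<^sub>+\<^sub>1 powr \<tau>\<close>, which telescopes.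
  By the Bernstein inequality \<open>b\<^sub>k = 2 powr (- k * \<alpha>) * N P\<^sub>k\<close> satisfies
  \<open>b\<^sub>k\<^sub>+\<^sub>1 \<le> q * b\<^sub>k + c * norm (P\<^sub>k\<^sub>+\<^sub>1 - P\<^sub>k)\<close> with \<open>q < 1\<close>, and the realization inequality controls
  \<open>E\<^sub>n\<close> and \<open>b\<^sub>n\<close>.

  Lower bound. Since \<open>G n\<close> need not be a subspace, \<open>E\<^sub>k\<close> is not the right quantity to telescope: the
  norming functional of \<open>f - P\<^sub>k\<^sub>+\<^sub>1\<close> need not vanish at \<open>P\<^sub>k\<^sub>+\<^sub>1\<close>. Instead one uses the limit \<open>D\<^sub>k\<close>
  of the distances from \<open>f\<close> to the shrinking sets \<open>G (2 ^ k) / l\<close>, \<open>l \<rightarrow> \<infinity>\<close>, which is the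
  distance to a subspace in good cases. It dominates \<open>E\<^sub>k\<close>, tends to 0 by the Jackson inequality and
  density, and uniform smoothness gives \<open>D\<^sub>k powr \<theta> \<le> D\<^sub>k\<^sub>+\<^sub>1 powr \<theta> + C * b\<^sub>k\<^sub>+\<^sub>1 powr \<theta>\<close>.
\<close>

section \<open>Uniform convexity and smoothness for vectors of arbitrary norm\<close>

text \<open>The modulus compares unit vectors only. After scaling to \<open>norm y = 1\<close>,
  normalizing \<open>x\<close> moves it by \<open>1 - norm x\<close>, and the hypothesis on the
  midpoint limits the convexity gain of the normalized pair to the same order. The right-hand side
  is a difference of powers so that it telescopes when the lemma is applied to consecutive
  errors.\<close>

lemma uniformly_convex_powr_gap:
  assumes "uniformly_convex TYPE('a::real_normed_vector) \<tau>" and \<tau>: "\<tau> > 1"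
  obtains C where "C > 0"
    and "\<And>x y :: 'a. norm x \<le> norm y \<Longrightarrow> norm x \<le> norm ((1/2) *\<^sub>R (x + y)) \<Longrightarrow>
           norm (x - y) powr \<tau> \<le> C * (norm y powr \<tau> - norm x powr \<tau>)"
proof -
  obtain c where c: "c > 0"
    and conv: "\<And>\<epsilon>. \<epsilon> \<in> {0..2} \<Longrightarrow> modulus_of_convexity TYPE('a) \<epsilon> \<ge> ereal (c * \<epsilon> powr \<tau>)"
    using assms unfolding uniformly_convex_def by blast
  \<comment> \<open>The factor \<open>2 powr \<tau>\<close> comes from the power of a sum,
    \<open>1 / c\<close> from the modulus; the summand 2 covers both short \<open>x\<close> and the
    cost of normalization.\<close>
  define C where "C = 2 powr \<tau> * (1 / c + 2)"
  have C: "C > 0" using c by (simp add: C_def add_pos_pos)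
  have unit: "norm ((1/2) *\<^sub>R (x + y)) \<le> 1 - c * norm (x - y) powr \<tau>"
    if "norm x = 1" "norm y = 1" for x y :: 'a
  proof -
    have "norm (x - y) \<in> {0..2}"
      using that norm_triangle_ineq4[of x y] by simp
    then have "ereal (c * norm (x - y) powr \<tau>) \<le> modulus_of_convexity TYPE('a) (norm (x - y))"
      by (rule conv)
    also have "\<dots> \<le> ereal (1 - norm ((1/2) *\<^sub>R (x + y)))"
      unfolding modulus_of_convexity_def by (rule Inf_lower) (use that in blast)
    finally show ?thesis by simp
  qed
  have normalized: "norm (x - y) powr \<tau> \<le> C * (1 - norm x powr \<tau>)"
    if y: "norm y = 1" and x: "norm x \<le> 1" and mid: "norm x \<le> norm ((1/2) *\<^sub>R (x + y))"
    for x y :: 'a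
  proof -
    define d where "d = norm x"
    have d: "0 \<le> d" "d \<le> 1" using x by (auto simp: d_def)
    have "d powr \<tau> \<le> d" 
      using d \<tau> powr_mono'[of 1 \<tau> d] by simp
    have "norm (x - y) powr \<tau> \<le> C * (1 - d)"
    \<comment> \<open>For short \<open>x\<close> the trivial bound
      \<open>norm (x - y) \<le> 2\<close> suffices, since \<open>1 - d\<close> exceeds 1/2;
      otherwise the factor \<open>d\<close> can be removed at the price of a constant.\<close>
    proof (cases "d < 1/2")
      case True
      have "norm (x - y) \<le> 2" using norm_triangle_ineq4[of x y] x y by simp
      then have "norm (x - y) powr \<tau> \<le> 2 powr \<tau>" using \<tau> by (intro powr_mono2) auto
      also have "\<dots> \<le> 2 powr \<tau> * (2 * (1 - d))" using True by simp
      also have "\<dots> \<le> C * (1 - d)"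
        unfolding C_def mult.assoc using c d by (intro mult_left_mono mult_right_mono) auto
      finally show ?thesis .
    next
      case False
      then have d2: "d \<ge> 1/2" "d > 0" by auto
      define x' where "x' = (1/d) *\<^sub>R x"
      have nx': "norm x' = 1" using d2 by (simp add: x'_def d_def)
      have xd: "x = d *\<^sub>R x'" using d2 by (simp add: x'_def)
      \<comment> \<open>The midpoint is \<open>d\<close> times a midpoint of unit vectors plus a
        remainder of norm \<open>(1 - d)/2\<close>. As its norm is at least \<open>d\<close>, this
        remainder bounds the convexity gain.\<close>
      have "(1/2) *\<^sub>R (x + y) = d *\<^sub>R ((1/2) *\<^sub>R (x' + y)) + ((1 - d)/2) *\<^sub>R y"
        by (simp add: xd algebra_simps diff_divide_distrib)
      then have "d \<le> norm (d *\<^sub>R ((1/2) *\<^sub>R (x' + y)) + ((1 - d)/2) *\<^sub>R y)"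
        using mid by (simp add: d_def)
      also have "\<dots> \<le> d * norm ((1/2) *\<^sub>R (x' + y)) + (1 - d)/2"
        by (rule order_trans[OF norm_triangle_ineq]) (use d y in simp)
      also have "\<dots> \<le> d * (1 - c * norm (x' - y) powr \<tau>) + (1 - d)/2"
        using unit[OF nx' y] d by (intro add_right_mono mult_left_mono) auto
      finally have *: "d * (c * norm (x' - y) powr \<tau>) \<le> (1 - d)/2" by (simp add: algebra_simps)
      have "1/2 * (c * norm (x' - y) powr \<tau>) \<le> d * (c * norm (x' - y) powr \<tau>)"
        using d2 c by (intro mult_right_mono) auto
      with * have "c * norm (x' - y) powr \<tau> \<le> 1 - d" by simp
      then have a: "norm (x' - y) powr \<tau> \<le> (1/c) * (1 - d)" using c by (simp add: field_simps)
      have b: "(1 - d) powr \<tau> \<le> 2 * (1 - d)"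
        using d \<tau> powr_mono'[of 1 \<tau> "1 - d"] by simp
      have "x - x' = (- (1 - d)) *\<^sub>R x'" by (simp add: xd algebra_simps)
      then have "norm (x - x') = 1 - d" using d nx' by (simp only: norm_scaleR) simp
      then have "norm (x - y) \<le> norm (x' - y) + (1 - d)"
        using norm_triangle_ineq[of "x - x'" "x' - y"] by simp
      also have "\<dots> \<le> 2 * max (norm (x' - y)) (1 - d)" by (auto simp: max_def)
      finally have "norm (x - y) powr \<tau> \<le> (2 * max (norm (x' - y)) (1 - d)) powr \<tau>"
        using \<tau> by (intro powr_mono2) auto
      also have "\<dots> = 2 powr \<tau> * max (norm (x' - y)) (1 - d) powr \<tau>"
        using d by (subst powr_mult) auto
      also have "\<dots> \<le> 2 powr \<tau> * (norm (x' - y) powr \<tau> + (1 - d) powr \<tau>)"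
        by (intro mult_left_mono) (auto simp: max_def)
      also have "\<dots> \<le> 2 powr \<tau> * ((1/c) * (1 - d) + 2 * (1 - d))"
        using a b by (intro mult_left_mono add_mono) auto
      also have "\<dots> = C * (1 - d)" by (simp add: C_def algebra_simps)
      finally show ?thesis .
    qed
    also have "\<dots> \<le> C * (1 - d powr \<tau>)"
      using C \<open>d powr \<tau> \<le> d\<close> by simp
    finally show ?thesis by (simp add: d_def)
  qed
  show thesis
  proof (rule that[OF C])
    fix x y :: 'a
    assume xy: "norm x \<le> norm y" and mid: "norm x \<le> norm ((1/2) *\<^sub>R (x + y))"
    show "norm (x - y) powr \<tau> \<le> C * (norm y powr \<tau> - norm x powr \<tau>)"
    proof (cases "y = 0")
      case True
      then show ?thesis using xy by simp
    next
      case False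
      define r where "r = norm y"
      have r: "r > 0" using False by (simp add: r_def)
      have sc: "norm ((1/r) *\<^sub>R z) = norm z / r" for z :: 'a using r by simp
      have "norm ((1/r) *\<^sub>R x - (1/r) *\<^sub>R y) powr \<tau> \<le> C * (1 - norm ((1/r) *\<^sub>R x) powr \<tau>)"
      proof (rule normalized)
        show "norm ((1/r) *\<^sub>R y) = 1" "norm ((1/r) *\<^sub>R x) \<le> 1"
          using r xy by (simp_all add: r_def)
        have "(1/2) *\<^sub>R ((1/r) *\<^sub>R x + (1/r) *\<^sub>R y) = (1/r) *\<^sub>R ((1/2) *\<^sub>R (x + y))"
          by (simp add: algebra_simps)
        then show "norm ((1/r) *\<^sub>R x) \<le> norm ((1/2) *\<^sub>R ((1/r) *\<^sub>R x + (1/r) *\<^sub>R y))"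
          unfolding sc using mid r by (simp only: sc) (intro divide_right_mono, auto)
      qed
      then have "(norm (x - y) / r) powr \<tau> \<le> C * (1 - (norm x / r) powr \<tau>)"
        by (simp only: sc flip: scaleR_diff_right)
      then have "norm (x - y) powr \<tau> / r powr \<tau> \<le> C * (1 - norm x powr \<tau> / r powr \<tau>)"
        using r by (simp add: powr_divide)
      then show ?thesis using r by (simp add: r_def field_simps)
    qed
  qed
qed

text \<open>Homogeneous form of smoothness: dividing by \<open>norm x\<close> gives the modulus at
  \<open>norm y / norm x\<close>. The case \<open>y = 0\<close> is separate because the modulus is
  bounded only at positive arguments.\<close>

lemma uniformly_smooth_norm_bound:
  assumes "uniformly_smooth TYPE('a::real_normed_vector) \<theta>"
  obtains c where "c > 0"
    and "\<And>x y :: 'a. x \<noteq> 0 \<Longrightarrow>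
           norm (x + y) + norm (x - y) \<le> 2 * norm x + c * (norm x * (norm y / norm x) powr \<theta>)"
proof -
  obtain c where c: "c > 0"
    and smooth: "\<And>t. t > 0 \<Longrightarrow> modulus_of_smoothness TYPE('a) t \<le> ereal (c * t powr \<theta>)"
    using assms unfolding uniformly_smooth_def by blast
  show thesis
  proof (rule that[of "2 * c"])
    fix x y :: 'a
    assume x: "x \<noteq> 0"
    define r where "r = norm x"
    have r: "r > 0" using x by (simp add: r_def)
    show "norm (x + y) + norm (x - y) \<le> 2 * norm x + 2 * c * (norm x * (norm y / norm x) powr \<theta>)"
    proof (cases "y = 0")
      case True
      then show ?thesis by simp
    next
      case False
      define x' y' where "x' = (1/r) *\<^sub>R x" and "y' = (1/r) *\<^sub>R y"
      have n: "norm x' = 1" "norm y' = norm y / r" "norm y / r > 0"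
        using r False by (simp_all add: x'_def y'_def r_def)
      have "ereal ((1/2) * (norm (x' + y') + norm (x' - y')) - 1)
              \<le> modulus_of_smoothness TYPE('a) (norm y / r)"
        unfolding modulus_of_smoothness_def by (rule Sup_upper) (use n in blast)
      also have "\<dots> \<le> ereal (c * (norm y / r) powr \<theta>)"
        using smooth n by blast
      finally have "(1/2) * (norm (x' + y') + norm (x' - y')) - 1 \<le> c * (norm y / r) powr \<theta>"
        by (simp only: ereal_less_eq)
      moreover have "s \<le> 2 + 2 * c * p" if "(1/2) * s - 1 \<le> c * p" for s p :: real
        using that by linarith
      ultimately have "norm (x' + y') + norm (x' - y') \<le> 2 + 2 * c * (norm y / r) powr \<theta>"
        by blast
      moreover have "norm (x' + y') = norm (x + y) / r" "norm (x' - y') = norm (x - y) / r"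
        using r by (simp_all add: x'_def y'_def flip: scaleR_add_right scaleR_diff_right)
      ultimately show ?thesis using r by (simp add: r_def[symmetric] field_simps)
    qed
  qed (use c in simp)
qed

section \<open>Power inequalities and summation\<close>

text \<open>Convexity of the power function at \<open>x\<close> and \<open>y / (1 - q)\<close> with
  weights \<open>q\<close> and \<open>1 - q\<close>. The first coefficient remains \<open>q\<close>,
  so a contraction survives taking powers; the second term carries the loss.\<close>

lemma powr_convex_combination:
  fixes q x y \<tau> :: real
  assumes "0 < q" "q < 1" "0 \<le> x" "0 \<le> y" "1 \<le> \<tau>"
  shows "(q * x + y) powr \<tau> \<le> q * x powr \<tau> + (1 - q) powr (1 - \<tau>) * y powr \<tau>"
proof (cases "x = 0 \<or> y = 0")
  case True
  have "q powr \<tau> \<le> q" using assms powr_mono'[of 1 \<tau> q] by simp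
  moreover have "1 \<le> (1 - q) powr (1 - \<tau>)" using assms powr_mono'[of "1 - \<tau>" 0 "1 - q"] by simp
  ultimately show ?thesis
    using True assms mult_right_mono[of "q powr \<tau>" q "x powr \<tau>"]
      mult_right_mono[of 1 "(1 - q) powr (1 - \<tau>)" "y powr \<tau>"]
    by (auto simp: powr_mult)
next
  case False
  have "((1 - q) *\<^sub>R (y / (1 - q)) + q *\<^sub>R x) powr \<tau>
          \<le> (1 - q) * (y / (1 - q)) powr \<tau> + q * x powr \<tau>"
    using convex_onD[OF powr_convex[of \<tau>], of q "y / (1 - q)" x] False assms by simp
  then show ?thesis using assms by (simp add: powr_divide powr_diff add.commute)
qed

text \<open>Mean value theorem with the intermediate point enlarged to \<open>b\<close>. The case
  \<open>a = 0\<close> is separate because the derivative formula is used on the whole closed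
  interval.\<close>

lemma powr_diff_le:
  fixes a b p :: real
  assumes "0 \<le> a" "a \<le> b" "1 \<le> p"
  shows "b powr p - a powr p \<le> p * b powr (p - 1) * (b - a)"
proof (cases "a = b \<or> a = 0")
  case True
  then show ?thesis
  proof
    assume "a = 0"
    have "b powr p = b powr (p - 1) * b" using assms by (cases "b = 0") (auto simp: powr_diff)
    moreover have "\<dots> \<le> p * (b powr (p - 1) * b)"
      using assms by (intro mult_right_mono[of 1 p, simplified]) auto
    ultimately show ?thesis using \<open>a = 0\<close> assms by simp
  qed simp
next
  case False
  then have ab: "0 < a" "a < b" using assms by auto
  obtain z where z: "a < z" "z < b" "b powr p - a powr p = (b - a) * (p * z powr (p - 1))"
    using MVT2[OF ab(2), of "\<lambda>x. x powr p" "\<lambda>x. p * x powr (p - 1)"] ab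
    by (force intro!: has_real_derivative_powr)
  have "z powr (p - 1) \<le> b powr (p - 1)" using z ab assms by (intro powr_mono2) auto
  then have "(b - a) * (p * z powr (p - 1)) \<le> (b - a) * (p * b powr (p - 1))"
    using ab assms by (intro mult_left_mono) auto
  then show ?thesis using z by (simp add: mult_ac)
qed

lemma nonneg_summable_on_atLeast_bound:
  fixes u :: "nat \<Rightarrow> real"
  assumes nonneg: "\<And>k. 0 \<le> u k" and bound: "\<And>m. sum u {n..m} \<le> B"
  shows "u summable_on {n..}" and "infsum u {n..} \<le> B"
proof -
  have *: "sum u F \<le> B" if F: "finite F" "F \<subseteq> {n..}" for F
  proof -
    obtain m where "F \<subseteq> {..m}" using F(1) finite_nat_iff_bounded_le by blast
    then have "F \<subseteq> {n..m}" using F(2) by auto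
    then have "sum u F \<le> sum u {n..m}" by (rule sum_mono2[rotated]) (use nonneg in auto)
    then show ?thesis using bound[of m] by simp
  qed
  show summable: "u summable_on {n..}"
    by (rule nonneg_bdd_above_summable_on) (use nonneg * in \<open>auto intro!: bdd_aboveI\<close>)
  show "infsum u {n..} \<le> B" by (rule infsum_le_finite_sums[OF summable *])
qed

lemma powr_sum_le_of_contraction:
  fixes a b :: "nat \<Rightarrow> real"
  assumes q: "0 < q" "q < 1" and \<tau>: "1 \<le> \<tau>"
    and nonneg: "\<And>k. 0 \<le> a k" "\<And>k. 0 \<le> b k"
    and rec: "\<And>k. b (Suc k) \<le> q * b k + a k"
  shows "(\<Sum>k=Suc n..m. b k powr \<tau>)
           \<le> (q * b n powr \<tau> + (1 - q) powr (1 - \<tau>) * (\<Sum>k=n..<m. a k powr \<tau>)) / (1 - q)"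
    (is "_ \<le> (_ + ?c * _) / _")
proof -
  have step: "b (Suc k) powr \<tau> \<le> q * b k powr \<tau> + ?c * a k powr \<tau>" for k
  proof -
    have "b (Suc k) powr \<tau> \<le> (q * b k + a k) powr \<tau>"
      using rec nonneg \<tau> by (intro powr_mono2) auto
    also have "\<dots> \<le> q * b k powr \<tau> + ?c * a k powr \<tau>"
      by (rule powr_convex_combination) (use q \<tau> nonneg in auto)
    finally show ?thesis .
  qed
  \<comment> \<open>The extra summand \<open>q * b (n+j) powr \<tau>\<close> on the left is exactly
    what the next use of \<open>step\<close> consumes.\<close>
  have ind: "(1 - q) * (\<Sum>k=Suc n..n+j. b k powr \<tau>) + q * b (n+j) powr \<tau>
          \<le> q * b n powr \<tau> + ?c * (\<Sum>k=n..<n+j. a k powr \<tau>)" for j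
  proof (induction j)
    case (Suc j)
    then show ?case using step[of "n+j"] by (simp add: algebra_simps)
  qed simp
  show ?thesis
  proof (cases "n \<le> m")
    case True
    then obtain j where "m = n + j" using le_Suc_ex by blast
    moreover have "0 \<le> q * b (n + j) powr \<tau>" using q by simp
    ultimately show ?thesis using ind[of j] q
      by (simp only: pos_le_divide_eq diff_gt_0_iff_gt mult.commute[of _ "1 - q"])
  qed (use q in simp)
qed

section \<open>Best approximants and the K-functional\<close>

locale approximation_scheme =
  fixes Y :: "'a::banach set" and N :: "'a \<Rightarrow> real"
    and G :: "nat \<Rightarrow> 'a set" and P :: "nat \<Rightarrow> 'a \<Rightarrow> 'a" and \<alpha> :: real
  assumes seminorm: "seminorm_on Y N"
    and family: "approx_family Y G"
    and best: "best_approximation G P"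
    and convex: "\<And>n. n \<ge> 1 \<Longrightarrow> convex (G n)"
    and \<alpha>: "\<alpha> > 0"
begin

lemma G_subset: "n \<ge> 1 \<Longrightarrow> G n \<subseteq> Y"
  using family by (simp add: approx_family_def)

lemma G_mono: "\<lbrakk>m \<le> n; 1 \<le> m\<rbrakk> \<Longrightarrow> G m \<subseteq> G n"
proof (induction n rule: dec_induct)
  case (step n)
  then have "G n \<subseteq> G (n + 1)" using family by (simp add: approx_family_def)
  with step show ?case by simp
qed simp

lemma G_uminus: "\<lbrakk>n \<ge> 1; g \<in> G n\<rbrakk> \<Longrightarrow> - g \<in> G n"
  using family unfolding approx_family_def by blast

lemma zero_in_G: "n \<ge> 1 \<Longrightarrow> 0 \<in> G n"
  using family G_mono[of 1 n] by (auto simp: approx_family_def)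

lemma G_midpoint: "\<lbrakk>n \<ge> 1; g \<in> G n; h \<in> G n\<rbrakk> \<Longrightarrow> (1/2) *\<^sub>R (g + h) \<in> G n"
  using convexD[OF convex, of n g h "1/2" "1/2"] by (simp add: scaleR_add_right)

lemma P_in_G: "n \<ge> 1 \<Longrightarrow> P n f \<in> G n"
  using best by (simp add: best_approximation_def)

lemma P_in_Y: "n \<ge> 1 \<Longrightarrow> P n f \<in> Y"
  using P_in_G G_subset by blast

lemma norm_diff_P_le:
  assumes "n \<ge> 1" "g \<in> G n" shows "norm (f - P n f) \<le> norm (f - g)"
proof -
  have "norm (f - P n f) = (INF g\<in>G n. norm (f - g))"
    using best assms by (simp add: best_approximation_def best_approx_error_def)
  also have "\<dots> \<le> norm (f - g)"
    by (rule cINF_lower[OF bdd_belowI2[of _ 0]]) (use assms in auto)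
  finally show ?thesis .
qed

lemma N_nonneg: "f \<in> Y \<Longrightarrow> 0 \<le> N f"
  using seminorm by (simp add: seminorm_on_def)

lemma N_scaleR: "f \<in> Y \<Longrightarrow> N (c *\<^sub>R f) = \<bar>c\<bar> * N f"
  using seminorm by (simp add: seminorm_on_def)

lemma N_le_add_diff:
  assumes "f \<in> Y" "g \<in> Y" shows "N f \<le> N g + N (f - g)"
proof -
  have "f - g \<in> Y" using seminorm assms by (auto simp: seminorm_on_def subspace_diff)
  then have "N (g + (f - g)) \<le> N g + N (f - g)"
    using seminorm assms unfolding seminorm_on_def by blast
  then show ?thesis by simp
qed

lemma scaleR_in_Y: "f \<in> Y \<Longrightarrow> c *\<^sub>R f \<in> Y"
  using seminorm by (simp add: seminorm_on_def subspace_scale)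

lemma K_functional_le: "\<lbrakk>g \<in> Y; 0 \<le> t\<rbrakk> \<Longrightarrow> K_functional Y N f t \<le> norm (f - g) + t * N g"
  unfolding K_functional_def
  by (rule cINF_lower[OF bdd_belowI2[of _ 0]]) (auto simp: N_nonneg)

lemma K_functional_nonneg: "0 \<le> t \<Longrightarrow> 0 \<le> K_functional Y N f t"
  unfolding K_functional_def
  by (rule cINF_greatest) (use P_in_Y[of 1] in \<open>auto simp: N_nonneg\<close>)

lemma norm_diff_P_dyadic_decreasing:
  "norm (f - P (2 ^ Suc k) f) \<le> norm (f - P (2 ^ k) f)"
  by (rule norm_diff_P_le) (use P_in_G[of "2^k" f] G_mono[of "2^k" "2^Suc k"] in auto)

section \<open>Upper estimate under uniform convexity\<close>

text \<open>The gap inequality is applied to the residuals of consecutive approximants: nestedness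
  makes the later one the shorter, convexity of the larger set admits the midpoint. After
  telescoping, the final error is dropped.\<close>

lemma sum_powr_P_diff_le:
  assumes "uniformly_convex TYPE('a) \<tau>" "\<tau> > 1"
  obtains C where "C > 0"
    and "\<And>f n m. (\<Sum>k=n..<m. norm (P (2 ^ Suc k) f - P (2 ^ k) f) powr \<tau>)
                    \<le> C * norm (f - P (2 ^ n) f) powr \<tau>"
proof -
  obtain C where C: "C > 0"
    and gap: "\<And>x y :: 'a. norm x \<le> norm y \<Longrightarrow> norm x \<le> norm ((1/2) *\<^sub>R (x + y)) \<Longrightarrow>
           norm (x - y) powr \<tau> \<le> C * (norm y powr \<tau> - norm x powr \<tau>)"
    using uniformly_convex_powr_gap[OF assms] by blast
  have step: "norm (P (2 ^ Suc k) f - P (2 ^ k) f) powr \<tau>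
      \<le> C * (norm (f - P (2 ^ k) f) powr \<tau> - norm (f - P (2 ^ Suc k) f) powr \<tau>)" for f k
  proof -
    let ?x = "f - P (2 ^ Suc k) f" and ?y = "f - P (2 ^ k) f"
    have "P (2 ^ k) f \<in> G (2 ^ Suc k)"
      using P_in_G[of "2^k" f] G_mono[of "2^k" "2^Suc k"] by auto
    then have "(1/2) *\<^sub>R (P (2 ^ Suc k) f + P (2 ^ k) f) \<in> G (2 ^ Suc k)"
      by (intro G_midpoint P_in_G) auto
    then have "norm ?x \<le> norm (f - (1/2) *\<^sub>R (P (2 ^ Suc k) f + P (2 ^ k) f))"
      by (intro norm_diff_P_le) auto
    also have "f - (1/2) *\<^sub>R (P (2 ^ Suc k) f + P (2 ^ k) f) = (1/2) *\<^sub>R (?x + ?y)"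
    proof -
      have "?x + ?y = 2 *\<^sub>R f - (P (2 ^ Suc k) f + P (2 ^ k) f)" by (simp add: scaleR_2)
      then show ?thesis by (simp only: scaleR_diff_right scaleR_scaleR) simp
    qed
    finally have "norm (?x - ?y) powr \<tau> \<le> C * (norm ?y powr \<tau> - norm ?x powr \<tau>)"
      by (intro gap norm_diff_P_dyadic_decreasing)
    then show ?thesis by (simp add: norm_minus_commute)
  qed
  have "(\<Sum>k=n..<m. norm (P (2 ^ Suc k) f - P (2 ^ k) f) powr \<tau>)
                    \<le> C * norm (f - P (2 ^ n) f) powr \<tau>" for f n m
  proof (cases "n \<le> m")
    case True
    let ?e = "\<lambda>k. norm (f - P (2 ^ k) f) powr \<tau>"
    have "(\<Sum>k=n..<m. norm (P (2 ^ Suc k) f - P (2 ^ k) f) powr \<tau>)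
            \<le> (\<Sum>k=n..<m. C * (?e k - ?e (Suc k)))"
      by (intro sum_mono step)
    also have "\<dots> = C * (?e n - ?e m)"
      using sum_Suc_diff'[OF True, of ?e]
      by (simp add: sum_distrib_left[symmetric] sum_subtractf)
    also have "\<dots> \<le> C * ?e n" using C by simp
    finally show ?thesis .
  qed (use C in simp)
  then show thesis using that C by blast
qed

text \<open>Only the data at level \<open>n\<close> are compared with the K-functional; the
  contraction carries the estimate to higher levels. Uniformity in \<open>m\<close> later yields
  summability too.\<close>

lemma upper_bound_of_uniformly_convex:
  assumes bernstein: "bernstein_inequality N G \<alpha>"
    and realization: "realization_inequality Y N G \<alpha>"
    and convexity: "uniformly_convex TYPE('a) \<tau>" "\<tau> > 1"
  obtains C where "C > 0"
    and "\<And>f n m. (\<Sum>k=Suc n..m. (2 powr (- real k * \<alpha>) * N (P (2 ^ k) f)) powr \<tau>)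
                  \<le> C * K_functional Y N f (2 powr (- real n * \<alpha>)) powr \<tau>"
proof -
  obtain c2 where c2: "c2 > 0"
    and bern: "\<And>n g h. n \<ge> 1 \<Longrightarrow> g \<in> G n \<Longrightarrow> h \<in> G n \<Longrightarrow>
        N (g - h) \<le> c2 * real n powr \<alpha> * norm (g - h)"
    using bernstein unfolding bernstein_inequality_def by blast
  obtain c3 where c3: "c3 > 0"
    and real: "\<And>n f. n \<ge> 1 \<Longrightarrow> (INF g\<in>G n. norm (f - g) + real n powr (-\<alpha>) * N g)
          \<le> c3 * K_functional Y N f (real n powr (-\<alpha>))"
    using realization unfolding realization_inequality_def by blast
  obtain c1 where c1: "c1 > 0"
    and sums: "\<And>f n m. (\<Sum>k=n..<m. norm (P (2 ^ Suc k) f - P (2 ^ k) f) powr \<tau>)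
                    \<le> c1 * norm (f - P (2 ^ n) f) powr \<tau>"
    using sum_powr_P_diff_le[OF convexity] by blast
  \<comment> \<open>Ratio of the weights of consecutive dyadic levels.\<close>
  define q where "q = 2 powr (-\<alpha>)"
  have q: "0 < q" "q < 1" using \<alpha> by (auto simp: q_def powr_less_one)
  define d where "d = (1 - q) powr (1 - \<tau>)"
  have d: "d \<ge> 0" by (simp add: d_def)
  have pos: "2 powr (real k * \<alpha>) * 2 powr (- real k * \<alpha>) = (1::real)" for k
    using powr_add[of 2 "real k * \<alpha>" "- real k * \<alpha>"] by simp
  have dyadic: "real (2 ^ k) powr \<beta> = 2 powr (real k * \<beta>)" for k \<beta>
    using powr_powr[of 2 "real k" \<beta>] by (simp add: powr_realpow)
  \<comment> \<open>The constant in \<open>b n \<le> A * ?K\<close>: \<open>1 + 2 * c2\<close> comes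
    from comparing \<open>P (2 ^ n) f\<close> with a competitor \<open>g\<close>, \<open>c3\<close>
    from the realization.\<close>
  define A where "A = (1 + 2 * c2) * c3"
  have A: "A > 0" "c3 > 0" using c2 c3 by (auto simp: A_def)
  define C where "C = (q * A powr \<tau> + d * (c2 powr \<tau> * (c1 * c3 powr \<tau>))) / (1 - q)"
  have C: "C > 0" using q A d c1 c2 unfolding C_def
    by (intro divide_pos_pos add_pos_nonneg mult_pos_pos mult_nonneg_nonneg) auto
  have "(\<Sum>k=Suc n..m. (2 powr (- real k * \<alpha>) * N (P (2 ^ k) f)) powr \<tau>)
                  \<le> C * K_functional Y N f (2 powr (- real n * \<alpha>)) powr \<tau>" for f n m
  proof -
    let ?K = "K_functional Y N f (2 powr (- real n * \<alpha>))"
    have K: "?K \<ge> 0" by (simp add: K_functional_nonneg)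
    define b where "b k = 2 powr (- real k * \<alpha>) * N (P (2 ^ k) f)" for k
    define a where "a k = c2 * norm (P (2 ^ Suc k) f - P (2 ^ k) f)" for k
    have b0: "b k \<ge> 0" and a0: "a k \<ge> 0" for k
      using N_nonneg[OF P_in_Y] c2 by (simp_all add: b_def a_def)
    \<comment> \<open>Bernstein is used in the larger of the two sets, where its factor cancels the
      weight of level \<open>Suc k\<close>.\<close>
    have rec: "b (Suc k) \<le> q * b k + a k" for k
    proof -
      have "P (2 ^ k) f \<in> G (2 ^ Suc k)"
        using P_in_G[of "2^k" f] G_mono[of "2^k" "2^Suc k"] by auto
      then have "N (P (2 ^ Suc k) f - P (2 ^ k) f)
           \<le> c2 * real (2 ^ Suc k) powr \<alpha> * norm (P (2 ^ Suc k) f - P (2 ^ k) f)"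
        by (intro bern P_in_G) auto
      then have "N (P (2 ^ Suc k) f - P (2 ^ k) f) \<le> 2 powr (real (Suc k) * \<alpha>) * a k"
        unfolding dyadic a_def by (simp only: mult_ac)
      moreover have "N (P (2 ^ Suc k) f) \<le> N (P (2 ^ k) f) + N (P (2 ^ Suc k) f - P (2 ^ k) f)"
        by (intro N_le_add_diff P_in_Y) auto
      ultimately have "N (P (2 ^ Suc k) f) \<le> N (P (2 ^ k) f) + 2 powr (real (Suc k) * \<alpha>) * a k"
        by linarith
      then have "b (Suc k) \<le> 2 powr (- real (Suc k) * \<alpha>) * (N (P (2 ^ k) f) + 2 powr (real (Suc k) * \<alpha>) * a k)"
        unfolding b_def by (intro mult_left_mono) auto
      also have "\<dots> = 2 powr (- real (Suc k) * \<alpha>) * N (P (2 ^ k) f) + a k"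
        using pos[of "Suc k"] by (simp only: distrib_left mult.assoc[symmetric] mult.commute[of "2 powr (- real (Suc k) * \<alpha>)" "2 powr (real (Suc k) * \<alpha>)"] mult_1)
      also have "2 powr (- real (Suc k) * \<alpha>) = q * 2 powr (- real k * \<alpha>)"
        unfolding q_def powr_add[symmetric] by (simp add: algebra_simps)
      finally show ?thesis by (simp add: b_def)
    qed
    \<comment> \<open>Realization bounds only an infimum over \<open>G (2 ^ n)\<close>, so it is
      used through arbitrary lower bounds \<open>x\<close>, without choosing a
      near-minimizer.\<close>
    have inf_le: "x \<le> c3 * ?K"
      if "\<And>g. g \<in> G (2 ^ n) \<Longrightarrow> x \<le> norm (f - g) + 2 powr (- real n * \<alpha>) * N g" for x
    proof -
      have "x \<le> (INF g\<in>G (2 ^ n). norm (f - g) + real (2 ^ n) powr (-\<alpha>) * N g)"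
        by (rule cINF_greatest) (use that zero_in_G[of "2^n"] in \<open>auto simp: dyadic simp del: of_nat_power\<close>)
      also have "\<dots> \<le> c3 * ?K" using real[of "2^n" f] by (simp add: dyadic del: of_nat_power)
      finally show ?thesis .
    qed
    have err: "norm (f - P (2 ^ n) f) \<le> c3 * ?K"
    proof (rule inf_le)
      fix g assume g: "g \<in> G (2 ^ n)"
      then have "norm (f - P (2 ^ n) f) \<le> norm (f - g)" by (intro norm_diff_P_le) auto
      moreover have "N g \<ge> 0" using g G_subset[of "2^n"] N_nonneg by auto
      ultimately show "norm (f - P (2 ^ n) f) \<le> norm (f - g) + 2 powr (- real n * \<alpha>) * N g"
        by (simp add: add_increasing2)
    qed
    have bn: "b n \<le> A * ?K"
    proof -
      have "b n / (1 + 2 * c2) \<le> c3 * ?K"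
      proof (rule inf_le)
        fix g assume g: "g \<in> G (2 ^ n)"
        then have gY: "g \<in> Y" using G_subset[of "2^n"] by auto
        have le: "norm (f - P (2 ^ n) f) \<le> norm (f - g)" using g by (intro norm_diff_P_le) auto
        have "norm (P (2 ^ n) f - g) \<le> norm (f - g) + norm (f - P (2 ^ n) f)"
          using norm_triangle_ineq4[of "f - g" "f - P (2 ^ n) f"] by simp
        with le have diff: "norm (P (2 ^ n) f - g) \<le> 2 * norm (f - g)" by simp
        have "N (P (2 ^ n) f) \<le> N g + N (P (2 ^ n) f - g)"
          by (intro N_le_add_diff P_in_Y gY) auto
        also have "N (P (2 ^ n) f - g) \<le> c2 * real (2 ^ n) powr \<alpha> * norm (P (2 ^ n) f - g)"
          using g by (intro bern P_in_G) auto
        also have "\<dots> \<le> c2 * 2 powr (real n * \<alpha>) * (2 * norm (f - g))"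
          unfolding dyadic using c2 diff by (intro mult_left_mono) auto
        finally have "b n \<le> 2 powr (- real n * \<alpha>) * (N g + c2 * 2 powr (real n * \<alpha>) * (2 * norm (f - g)))"
          unfolding b_def by (intro mult_left_mono) auto
        also have "\<dots> = 2 powr (- real n * \<alpha>) * N g + 2 * c2 * norm (f - g) * (2 powr (real n * \<alpha>) * 2 powr (- real n * \<alpha>))"
          by (simp add: algebra_simps)
        also have "\<dots> \<le> (1 + 2 * c2) * (norm (f - g) + 2 powr (- real n * \<alpha>) * N g)"
        proof -
          have "0 \<le> c2 * (2 powr (- real n * \<alpha>) * N g)" using c2 N_nonneg[OF gY] by simp
          then show ?thesis unfolding pos by (simp add: algebra_simps)
        qed
        finally show "b n / (1 + 2 * c2) \<le> norm (f - g) + 2 powr (- real n * \<alpha>) * N g"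
          using c2 by (simp add: field_simps)
      qed
      then show ?thesis using c2 by (simp add: A_def field_simps)
    qed
    have "(\<Sum>k=Suc n..m. b k powr \<tau>) \<le> (q * b n powr \<tau> + d * (\<Sum>k=n..<m. a k powr \<tau>)) / (1 - q)"
      unfolding d_def by (rule powr_sum_le_of_contraction) (use q a0 b0 rec convexity(2) in auto)
    also have "(\<Sum>k=n..<m. a k powr \<tau>)
        = c2 powr \<tau> * (\<Sum>k=n..<m. norm (P (2 ^ Suc k) f - P (2 ^ k) f) powr \<tau>)"
      using c2 by (simp add: a_def powr_mult sum_distrib_left)
    also have "(q * b n powr \<tau> + d * (c2 powr \<tau> * (\<Sum>k=n..<m. norm (P (2 ^ Suc k) f - P (2 ^ k) f) powr \<tau>))) / (1 - q)
        \<le> (q * (A * ?K) powr \<tau> + d * (c2 powr \<tau> * (c1 * (c3 * ?K) powr \<tau>))) / (1 - q)"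
    proof (intro divide_right_mono add_mono mult_left_mono powr_mono2)
      have "norm (f - P (2 ^ n) f) powr \<tau> \<le> (c3 * ?K) powr \<tau>"
        using err convexity(2) by (intro powr_mono2) auto
      then show "(\<Sum>k=n..<m. norm (P (2 ^ Suc k) f - P (2 ^ k) f) powr \<tau>) \<le> c1 * (c3 * ?K) powr \<tau>"
        using order_trans[OF sums] c1 by simp
    qed (use q d bn b0 convexity(2) in auto)
    also have "\<dots> = C * ?K powr \<tau>"
    proof -
      have "(A * ?K) powr \<tau> = A powr \<tau> * ?K powr \<tau>" "(c3 * ?K) powr \<tau> = c3 powr \<tau> * ?K powr \<tau>"
        using A K by (simp_all add: powr_mult)
      then show ?thesis unfolding C_def by (simp only:) (simp add: algebra_simps)
    qed
    finally show ?thesis by (simp add: b_def)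
  qed
  then show thesis using that C by blast
qed

section \<open>Approximation from shrunken sets\<close>

text \<open>For real \<open>l\<close>, the element
  \<open>(1/l) *\<^sub>R P n (l *\<^sub>R f)\<close> is a best approximant of \<open>f\<close> from
  \<open>G n\<close> scaled by \<open>1/l\<close>. The errors increase with \<open>l\<close>
  (\<open>scaled_error_mono\<close>), so the supremum is their limit.\<close>

definition limit_error :: "nat \<Rightarrow> 'a \<Rightarrow> real" where
  "limit_error n f = (SUP l\<in>{1..}. norm (f - (1/l) *\<^sub>R P n (l *\<^sub>R f)))"

lemma scaled_error_le:
  assumes "n \<ge> 1" "l > 0" "g \<in> G n"
  shows "norm (f - (1/l) *\<^sub>R P n (l *\<^sub>R f)) \<le> norm (f - (1/l) *\<^sub>R g)"
proof -
  have *: "l * norm (f - (1/l) *\<^sub>R h) = norm (l *\<^sub>R f - h)" for h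
  proof -
    have "l *\<^sub>R f - h = l *\<^sub>R (f - (1/l) *\<^sub>R h)" using assms by (simp add: scaleR_diff_right)
    then show ?thesis using assms by simp
  qed
  have "norm (l *\<^sub>R f - P n (l *\<^sub>R f)) \<le> norm (l *\<^sub>R f - g)"
    using assms by (intro norm_diff_P_le)
  then show ?thesis unfolding *[symmetric] using assms by simp
qed

text \<open>A convex set containing 0 is closed under multiplication by \<open>l/l'\<close>, so the
  scaled sets shrink as the parameter grows.\<close>

lemma scaled_error_mono:
  assumes "n \<ge> 1" "0 < l" "l \<le> l'"
  shows "norm (f - (1/l) *\<^sub>R P n (l *\<^sub>R f)) \<le> norm (f - (1/l') *\<^sub>R P n (l' *\<^sub>R f))"
proof -
  have "(l/l') *\<^sub>R P n (l' *\<^sub>R f) + (1 - l/l') *\<^sub>R 0 \<in> G n"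
    using assms by (intro convexD[OF convex] P_in_G zero_in_G) auto
  then have "norm (f - (1/l) *\<^sub>R P n (l *\<^sub>R f)) \<le> norm (f - (1/l) *\<^sub>R ((l/l') *\<^sub>R P n (l' *\<^sub>R f)))"
    using assms by (intro scaled_error_le) simp_all
  also have "(1/l) *\<^sub>R ((l/l') *\<^sub>R P n (l' *\<^sub>R f)) = (1/l') *\<^sub>R P n (l' *\<^sub>R f)"
    using assms by simp
  finally show ?thesis .
qed

lemma scaled_error_le_limit_error:
  assumes "n \<ge> 1" "l \<ge> 1"
  shows "norm (f - (1/l) *\<^sub>R P n (l *\<^sub>R f)) \<le> limit_error n f"
  unfolding limit_error_def
proof (rule cSUP_upper)
  show "bdd_above ((\<lambda>l. norm (f - (1/l) *\<^sub>R P n (l *\<^sub>R f))) ` {1..})"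
    by (rule bdd_aboveI2[of _ _ "norm f"])
      (use scaled_error_le[OF assms(1) _ zero_in_G[OF assms(1)]] in force)
qed (use assms in simp)

lemma limit_error_le:
  assumes "\<And>l. l \<ge> 1 \<Longrightarrow> norm (f - (1/l) *\<^sub>R P n (l *\<^sub>R f)) \<le> B"
  shows "limit_error n f \<le> B"
  unfolding limit_error_def by (rule cSUP_least) (use assms in auto)

lemma error_le_limit_error: "n \<ge> 1 \<Longrightarrow> norm (f - P n f) \<le> limit_error n f"
  using scaled_error_le_limit_error[of n 1 f] by simp

lemma limit_error_nonneg: "n \<ge> 1 \<Longrightarrow> 0 \<le> limit_error n f"
  using error_le_limit_error[of n f] norm_ge_zero order_trans by blast

lemma limit_error_antimono:
  assumes "1 \<le> n" "n \<le> m" shows "limit_error m f \<le> limit_error n f"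
proof (rule limit_error_le)
  fix l :: real assume l: "l \<ge> 1"
  have "norm (f - (1/l) *\<^sub>R P m (l *\<^sub>R f)) \<le> norm (f - (1/l) *\<^sub>R P n (l *\<^sub>R f))"
    using assms l P_in_G[OF assms(1)] G_mono[OF assms(2,1)] by (intro scaled_error_le) auto
  also have "\<dots> \<le> limit_error n f" using assms l by (intro scaled_error_le_limit_error)
  finally show "norm (f - (1/l) *\<^sub>R P m (l *\<^sub>R f)) \<le> limit_error n f" .
qed

text \<open>Homogeneity of \<open>N\<close> makes the Jackson bound independent of \<open>l\<close>,
  so it passes to the limit error.\<close>

lemma scaled_error_bound:
  assumes jackson: "\<And>g. g \<in> Y \<Longrightarrow> norm (g - P n g) \<le> t * N g" and "l > 0" "g \<in> Y"
  shows "norm (g - (1/l) *\<^sub>R P n (l *\<^sub>R g)) \<le> t * N g"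
proof -
  have "g - (1/l) *\<^sub>R P n (l *\<^sub>R g) = (1/l) *\<^sub>R (l *\<^sub>R g - P n (l *\<^sub>R g))"
    using assms by (simp add: scaleR_diff_right)
  then have "norm (g - (1/l) *\<^sub>R P n (l *\<^sub>R g)) = norm (l *\<^sub>R g - P n (l *\<^sub>R g)) / l"
    using assms by simp
  also have "\<dots> \<le> t * N (l *\<^sub>R g) / l"
    using assms by (intro divide_right_mono jackson scaleR_in_Y) auto
  also have "\<dots> = t * N g" using assms by (simp add: N_scaleR)
  finally show ?thesis .
qed

text \<open>The scaled approximant of \<open>g\<close> serves as competitor for \<open>f\<close>,
  which avoids any linearity of \<open>P\<close>.\<close>

lemma limit_error_le_K:
  assumes n: "n \<ge> 1" and jackson: "\<And>g. g \<in> Y \<Longrightarrow> norm (g - P n g) \<le> t * N g" and g: "g \<in> Y"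
  shows "limit_error n f \<le> norm (f - g) + t * N g"
proof (rule limit_error_le)
  fix l :: real assume l: "l \<ge> 1"
  have "norm (f - (1/l) *\<^sub>R P n (l *\<^sub>R f)) \<le> norm (f - (1/l) *\<^sub>R P n (l *\<^sub>R g))"
    using n l by (intro scaled_error_le P_in_G) auto
  also have "\<dots> \<le> norm (f - g) + norm (g - (1/l) *\<^sub>R P n (l *\<^sub>R g))"
    using norm_triangle_ineq[of "f - g" "g - (1/l) *\<^sub>R P n (l *\<^sub>R g)"] by simp
  also have "\<dots> \<le> norm (f - g) + t * N g"
    using l g scaled_error_bound[OF jackson] by simp
  finally show "norm (f - (1/l) *\<^sub>R P n (l *\<^sub>R f)) \<le> norm (f - g) + t * N g" .
qed

section \<open>Lower estimate under uniform smoothness\<close>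

text \<open>Let \<open>x = f - P m f\<close> and let \<open>y\<close> be the error of approximating
  \<open>P m f\<close> from a shrunken \<open>G n\<close>, so \<open>norm y\<close> is at most
  \<open>t * N (P m f)\<close>. Then \<open>x + y\<close> is a residual of \<open>f\<close> at level
  \<open>n\<close>, while optimality of \<open>P m f\<close> makes \<open>norm (x - y)\<close> at
  least \<open>2 * norm x\<close> minus the limit error at level \<open>m\<close>, up to \<epsilon>.
  Smoothness combines the two, and \<open>powr_diff_le\<close> passes to powers.\<close>

lemma limit_error_step:
  assumes smooth: "\<And>x y :: 'a. x \<noteq> 0 \<Longrightarrow>
           norm (x + y) + norm (x - y) \<le> 2 * norm x + c * (norm x * (norm y / norm x) powr \<theta>)"
    and c: "c > 0" and \<theta>: "\<theta> > 1"
    and n: "1 \<le> n" "n \<le> m"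
    and jackson: "\<And>g. g \<in> Y \<Longrightarrow> norm (g - P n g) \<le> t * N g"
  shows "limit_error n f powr \<theta> \<le> limit_error m f powr \<theta>
           + (2 powr \<theta> + \<theta> * 2 powr (\<theta> - 1) * c) * (t * N (P m f)) powr \<theta>"
proof -
  define w where "w = P m f"
  define x where "x = f - w"
  define b where "b = t * N w"
  have m: "m \<ge> 1" using n by simp
  have w: "w \<in> G m" "w \<in> Y" using m by (simp_all add: w_def P_in_G P_in_Y)
  have b: "b \<ge> 0" using jackson[OF w(2)] norm_ge_zero order_trans unfolding b_def by blast
  have 1: "limit_error n f \<le> norm x + b"
    unfolding x_def b_def by (rule limit_error_le_K[OF n(1) jackson w(2)])
  note nonneg = limit_error_nonneg[OF n(1)] limit_error_nonneg[OF m]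
  have c2: "\<theta> * 2 powr (\<theta> - 1) * c \<ge> 0" using \<theta> c by simp
  have "limit_error n f powr \<theta> \<le> limit_error m f powr \<theta>
           + (2 powr \<theta> + \<theta> * 2 powr (\<theta> - 1) * c) * b powr \<theta>"
  \<comment> \<open>For \<open>norm x \<le> b\<close> the bound \<open>1\<close> alone gives
    \<open>2 * b\<close>; otherwise \<open>x\<close> is nonzero and smoothness applies.\<close>
  proof (cases "norm x \<le> b")
    case True
    then have "limit_error n f powr \<theta> \<le> (2 * b) powr \<theta>"
      using 1 nonneg \<theta> by (intro powr_mono2) auto
    also have "\<dots> = 2 powr \<theta> * b powr \<theta>" using b by (simp add: powr_mult)
    also have "\<dots> \<le> (2 powr \<theta> + \<theta> * 2 powr (\<theta> - 1) * c) * b powr \<theta>"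
      using c2 by (intro mult_right_mono) auto
    finally show ?thesis by (simp add: add_increasing)
  next
    case False
    then have x: "x \<noteq> 0" "norm x > 0" using b by auto
    define e where "e = c * (norm x * (b / norm x) powr \<theta>)"
    have "limit_error n f \<le> limit_error m f + e"
    proof (rule limit_error_le, rule field_le_epsilon)
      fix l \<epsilon> :: real assume l: "l \<ge> 1" and \<epsilon>: "\<epsilon> > 0"
      \<comment> \<open>The scale must be at least \<open>l\<close> for monotonicity and large
        enough that the perturbation cost \<open>2 * norm w / \<mu>\<close> is at most
        \<epsilon>.\<close>
      define \<mu> where "\<mu> = max l (2 * norm w / \<epsilon>)"
      have \<mu>: "\<mu> \<ge> 1" "l \<le> \<mu>" "2 * norm w / \<epsilon> \<le> \<mu>" using l by (auto simp: \<mu>_def)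
      then have small: "2 * norm w / \<mu> \<le> \<epsilon>" using \<epsilon> by (simp add: field_simps)
      define p p' where "p = P n (\<mu> *\<^sub>R w)" and "p' = P m (\<mu> *\<^sub>R f)"
      define y where "y = w - (1/\<mu>) *\<^sub>R p"
      have p: "p \<in> G n" "p \<in> G m" "p' \<in> G m"
        using P_in_G n m G_mono[OF n(2,1)] by (auto simp: p_def p'_def)
      have y: "norm y \<le> b"
        unfolding y_def p_def b_def using \<mu> w by (intro scaled_error_bound jackson) auto
      have "norm x \<le> norm (x + (1/2) *\<^sub>R ((1/\<mu>) *\<^sub>R (p - p'))) + norm w / \<mu>"
      proof -
        \<comment> \<open>Symmetry and convexity put \<open>u\<close> in \<open>G m\<close>. Moving
          from the best approximant \<open>w\<close> towards \<open>u\<close> by the fraction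
          \<open>1/\<mu>\<close> stays in \<open>G m\<close>, a discrete first-order optimality
          condition.\<close>
        define u where "u = (1/2) *\<^sub>R (p' + - p)"
        have "u \<in> G m" unfolding u_def using m p by (intro G_midpoint G_uminus)
        then have "(1 - 1/\<mu>) *\<^sub>R w + (1/\<mu>) *\<^sub>R u \<in> G m"
          using m w \<mu> by (intro convexD[OF convex]) auto
        then have "norm x \<le> norm (f - ((1 - 1/\<mu>) *\<^sub>R w + (1/\<mu>) *\<^sub>R u))"
          unfolding x_def w_def using m by (intro norm_diff_P_le) auto
        also have "f - ((1 - 1/\<mu>) *\<^sub>R w + (1/\<mu>) *\<^sub>R u)
            = (x + (1/2) *\<^sub>R ((1/\<mu>) *\<^sub>R (p - p'))) + (1/\<mu>) *\<^sub>R w"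
          by (simp add: x_def u_def algebra_simps)
        also have "norm \<dots> \<le> norm (x + (1/2) *\<^sub>R ((1/\<mu>) *\<^sub>R (p - p'))) + norm ((1/\<mu>) *\<^sub>R w)"
          by (rule norm_triangle_ineq)
        finally show ?thesis using \<mu> by simp
      qed
      \<comment> \<open>this lower bound for \<open>norm (x - y)\<close> replaces the norming functional of \<open>x\<close>\<close>
      moreover have "2 * norm (x + (1/2) *\<^sub>R ((1/\<mu>) *\<^sub>R (p - p')))
          \<le> norm (x - y) + norm (f - (1/\<mu>) *\<^sub>R p')"
      proof -
        have "2 *\<^sub>R (x + (1/2) *\<^sub>R ((1/\<mu>) *\<^sub>R (p - p'))) = (x - y) + (f - (1/\<mu>) *\<^sub>R p')"
          by (simp add: x_def y_def scaleR_2 algebra_simps)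
        then have "norm (2 *\<^sub>R (x + (1/2) *\<^sub>R ((1/\<mu>) *\<^sub>R (p - p'))))
            \<le> norm (x - y) + norm (f - (1/\<mu>) *\<^sub>R p')"
          by (simp only: norm_triangle_ineq)
        then show ?thesis by (simp only: norm_scaleR)
      qed
      moreover have "norm (f - (1/\<mu>) *\<^sub>R p') \<le> limit_error m f"
        unfolding p'_def using m \<mu> by (intro scaled_error_le_limit_error)
      moreover have "norm (x + y) + norm (x - y) \<le> 2 * norm x + e"
      proof -
        have "norm x * (norm y / norm x) powr \<theta> \<le> norm x * (b / norm x) powr \<theta>"
          using y x \<theta> by (intro mult_left_mono powr_mono2 divide_right_mono) auto
        then show ?thesis using smooth[OF x(1), of y] c
            mult_left_mono[of "norm x * (norm y / norm x) powr \<theta>" "norm x * (b / norm x) powr \<theta>" c]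
          unfolding e_def by linarith
      qed
      ultimately have "norm (x + y) \<le> limit_error m f + e + \<epsilon>" using small by simp
      moreover have "x + y = f - (1/\<mu>) *\<^sub>R p" by (simp add: x_def y_def)
      \<comment> \<open>Raising the scale from \<open>l\<close> to \<mu> only increases the error,
        and at scale \<mu> the element \<open>p\<close> is admissible.\<close>
      moreover have "norm (f - (1/l) *\<^sub>R P n (l *\<^sub>R f)) \<le> norm (f - (1/\<mu>) *\<^sub>R P n (\<mu> *\<^sub>R f))"
        using n l \<mu> by (intro scaled_error_mono) auto
      moreover have "\<dots> \<le> norm (f - (1/\<mu>) *\<^sub>R p)"
        using n \<mu> p by (intro scaled_error_le) auto
      ultimately show "norm (f - (1/l) *\<^sub>R P n (l *\<^sub>R f)) \<le> limit_error m f + e + \<epsilon>"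
        by simp
    qed
    \<comment> \<open>\<open>limit_error n f\<close> is at most \<open>2 * norm x\<close> here, which cancels the factor \<open>norm x powr (1 - \<theta>)\<close> in \<open>e\<close>\<close>
    then have "limit_error n f - limit_error m f \<le> e" by simp
    moreover have "limit_error n f powr (\<theta> - 1) \<le> (2 * norm x) powr (\<theta> - 1)"
      using 1 False nonneg \<theta> by (intro powr_mono2) auto
    ultimately have "\<theta> * limit_error n f powr (\<theta> - 1) * (limit_error n f - limit_error m f)
        \<le> \<theta> * (2 * norm x) powr (\<theta> - 1) * e"
      using \<theta> limit_error_antimono[OF n, of f] by (intro mult_mono mult_left_mono) auto
    also have "\<dots> = \<theta> * 2 powr (\<theta> - 1) * c * b powr \<theta>"
      using x b by (simp add: e_def powr_mult powr_divide powr_diff)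
    finally have "limit_error n f powr \<theta> - limit_error m f powr \<theta> \<le> \<theta> * 2 powr (\<theta> - 1) * c * b powr \<theta>"
      using powr_diff_le[OF nonneg(2) limit_error_antimono[OF n, of f] less_imp_le[OF \<theta>]] by linarith
    moreover have "0 \<le> 2 powr \<theta> * b powr \<theta>" by simp
    ultimately show ?thesis unfolding distrib_right by linarith
  qed
  then show ?thesis by (simp add: b_def w_def)
qed

text \<open>Density supplies a fixed \<open>g\<close> near \<open>f\<close>; the Jackson term in
  \<open>limit_error_le_K\<close> then decays geometrically in \<open>k\<close>.\<close>

lemma limit_error_dyadic_small:
  assumes jackson: "\<And>k g. g \<in> Y \<Longrightarrow> norm (g - P (2 ^ k) g) \<le> c * 2 powr (- real k * \<alpha>) * N g"
    and c: "c > 0" and \<epsilon>: "\<epsilon> > 0"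
  obtains m where "m \<ge> n" "limit_error (2 ^ m) f \<le> \<epsilon>"
proof -
  have "f \<in> closure (\<Union>n\<in>{1..}. G n)" using family by (simp add: approx_family_def)
  then obtain g where g: "g \<in> (\<Union>n\<in>{1..}. G n)" "dist g f < \<epsilon>/2"
    using \<epsilon> by (meson closure_approachable half_gt_zero)
  then have gY: "g \<in> Y" using G_subset by auto
  have fg: "norm (f - g) < \<epsilon>/2" using g by (simp add: dist_norm norm_minus_commute)
  \<comment> \<open>Using \<open>N g + 1\<close> keeps the denominator positive, since a seminorm
    may vanish at \<open>g\<close>.\<close>
  define \<delta> where "\<delta> = \<epsilon> / (2 * c * (N g + 1))"
  have "N g + 1 > 0" using N_nonneg[OF gY] by simp
  then have "\<delta> > 0" using c \<epsilon> by (simp add: \<delta>_def)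
  then obtain k where "(2 powr (-\<alpha>)) ^ k < \<delta>"
    using real_arch_pow_inv[of \<delta> "2 powr (-\<alpha>)"] \<alpha> by (auto simp: powr_less_one)
  then have k: "2 powr (- real k * \<alpha>) \<le> \<delta>" by (simp add: powr_power mult.commute)
  have "c * 2 powr (- real k * \<alpha>) * N g \<le> c * \<delta> * (N g + 1)"
    using k c N_nonneg[OF gY] \<open>\<delta> > 0\<close> by (intro mult_mono) auto
  also have "\<dots> = \<epsilon>/2" using c \<open>N g + 1 > 0\<close> by (simp add: \<delta>_def divide_simps)
  finally have "limit_error (2 ^ k) f \<le> \<epsilon>"
    using limit_error_le_K[OF _ jackson gY, of k f] fg by simp
  moreover have "limit_error (2 ^ max k n) f \<le> limit_error (2 ^ k) f"
    by (rule limit_error_antimono) (auto intro: power_increasing)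
  ultimately show thesis using that[of "max k n"] by simp
qed

text \<open>Telescoping \<open>limit_error_step\<close> bounds the limit error at level
  \<open>n\<close>, and one further term of the sum controls the seminorm of a competitor in the
  K-functional.\<close>

lemma lower_bound_of_uniformly_smooth:
  assumes jackson: "jackson_inequality Y N G \<alpha>"
    and smoothness: "uniformly_smooth TYPE('a) \<theta>" "\<theta> > 1"
  obtains C where "C > 0"
    and "\<And>f n S. (\<And>m. (\<Sum>k=Suc n..m. (2 powr (- real k * \<alpha>) * N (P (2 ^ k) f)) powr \<theta>) \<le> S) \<Longrightarrow>
           K_functional Y N f (2 powr (- real n * \<alpha>)) \<le> C * S powr (1 / \<theta>)"
proof -
  obtain c1 where c1: "c1 > 0"
    and jack: "\<And>n f. f \<in> Y \<Longrightarrow> n \<ge> 1 \<Longrightarrow> best_approx_error G n f \<le> c1 * real n powr (-\<alpha>) * N f"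
    using jackson unfolding jackson_inequality_def by blast
  have dyadic: "real (2 ^ k) powr \<beta> = 2 powr (real k * \<beta>)" for k \<beta>
    using powr_powr[of 2 "real k" \<beta>] by (simp add: powr_realpow)
  have jack2: "norm (g - P (2 ^ k) g) \<le> c1 * 2 powr (- real k * \<alpha>) * N g" if "g \<in> Y" for g k
    using jack[OF that, of "2^k"] best
    by (simp add: best_approximation_def dyadic del: of_nat_power)
  obtain c where c: "c > 0"
    and smooth: "\<And>x y :: 'a. x \<noteq> 0 \<Longrightarrow>
           norm (x + y) + norm (x - y) \<le> 2 * norm x + c * (norm x * (norm y / norm x) powr \<theta>)"
    using uniformly_smooth_norm_bound[OF smoothness(1)] by blast
  \<comment> \<open>The Jackson weight of level \<open>k\<close> meets the approximant of level
    \<open>Suc k\<close>; \<open>2 powr \<alpha>\<close> converts one weight into the other.\<close>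
  define A where "A = c1 * 2 powr \<alpha>"
  define M where "M = (2 powr \<theta> + \<theta> * 2 powr (\<theta> - 1) * c) * A powr \<theta>"
  have A: "A > 0" using c1 by (simp add: A_def)
  have M: "M > 0" using A c smoothness(2) by (simp add: M_def add_pos_pos)
  have bound: "K_functional Y N f (2 powr (- real n * \<alpha>)) \<le> (M powr (1/\<theta>) + 2 powr \<alpha>) * S powr (1 / \<theta>)"
    if S: "\<And>m. (\<Sum>k=Suc n..m. (2 powr (- real k * \<alpha>) * N (P (2 ^ k) f)) powr \<theta>) \<le> S" for f n S
  proof -
    define b where "b k = 2 powr (- real k * \<alpha>) * N (P (2 ^ k) f)" for k
    have b0: "b k \<ge> 0" for k using N_nonneg[OF P_in_Y] by (simp add: b_def)
    define D where "D k = limit_error (2 ^ k) f" for k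
    have D0: "D k \<ge> 0" for k unfolding D_def by (rule limit_error_nonneg) simp
    have shift: "2 powr (- real k * \<alpha>) = 2 powr \<alpha> * 2 powr (- real (Suc k) * \<alpha>)" for k
      unfolding powr_add[symmetric] by (simp add: algebra_simps)
    have step: "D k powr \<theta> \<le> D (Suc k) powr \<theta> + M * b (Suc k) powr \<theta>" for k
    proof -
      have "D k powr \<theta> \<le> D (Suc k) powr \<theta> + (2 powr \<theta> + \<theta> * 2 powr (\<theta> - 1) * c) *
              (c1 * 2 powr (- real k * \<alpha>) * N (P (2 ^ Suc k) f)) powr \<theta>"
        unfolding D_def by (rule limit_error_step[OF smooth c smoothness(2) _ _ jack2]) auto
      also have "c1 * 2 powr (- real k * \<alpha>) * N (P (2 ^ Suc k) f) = A * b (Suc k)"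
        unfolding shift[of k] A_def b_def by (simp only: mult_ac)
      also have "(A * b (Suc k)) powr \<theta> = A powr \<theta> * b (Suc k) powr \<theta>"
        using A b0 by (simp add: powr_mult)
      finally show ?thesis by (simp only: M_def mult.assoc)
    qed
    have telescope: "D n powr \<theta> \<le> D (n + j) powr \<theta> + M * (\<Sum>k=Suc n..n+j. b k powr \<theta>)" for j
    proof (induction j)
      case (Suc j)
      then show ?case using step[of "n + j"] by (simp add: distrib_left)
    qed simp
    have "D n powr \<theta> \<le> M * S"
    proof (rule field_le_epsilon)
      fix \<delta> :: real assume \<delta>: "\<delta> > 0"
      \<comment> \<open>Since \<open>S\<close> bounds every partial sum, only \<open>D m\<close> has
        to be made small, and a single \<open>m\<close> suffices for each \<delta>.\<close>
      obtain m where m: "m \<ge> n" "D m \<le> \<delta> powr (1/\<theta>)"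
        unfolding D_def using limit_error_dyadic_small[OF jack2 c1, of "\<delta> powr (1/\<theta>)" n f] \<delta> by auto
      then obtain j where j: "m = n + j" using le_Suc_ex by blast
      have "D n powr \<theta> \<le> D m powr \<theta> + M * (\<Sum>k=Suc n..m. b k powr \<theta>)"
        using telescope[of j] j by simp
      also have "D m powr \<theta> \<le> (\<delta> powr (1/\<theta>)) powr \<theta>"
        using m D0 smoothness(2) by (intro powr_mono2) auto
      also have "\<dots> = \<delta>" using \<delta> smoothness(2) by (simp add: powr_powr)
      also have "M * (\<Sum>k=Suc n..m. b k powr \<theta>) \<le> M * S"
        using S[of m] M by (simp add: b_def)
      finally show "D n powr \<theta> \<le> M * S + \<delta>" by simp
    qed
    then have "(D n powr \<theta>) powr (1/\<theta>) \<le> (M * S) powr (1/\<theta>)"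
      using smoothness(2) by (intro powr_mono2) auto
    moreover have S0: "S \<ge> 0" using S[of n] by simp
    ultimately have Dn: "D n \<le> M powr (1/\<theta>) * S powr (1/\<theta>)"
      using D0[of n] M smoothness(2) by (simp add: powr_powr powr_mult)
    have "(b (Suc n) powr \<theta>) powr (1/\<theta>) \<le> S powr (1/\<theta>)"
      using S[of "Suc n"] smoothness(2) by (intro powr_mono2) (auto simp: b_def)
    then have bn: "b (Suc n) \<le> S powr (1/\<theta>)"
      using b0[of "Suc n"] smoothness(2) by (simp add: powr_powr)
    \<comment> \<open>The competitor has level \<open>Suc n\<close>, not \<open>n\<close>: the sum
      starts there, so it contains \<open>b (Suc n)\<close> but not \<open>b n\<close>.\<close>
    have "K_functional Y N f (2 powr (- real n * \<alpha>))
        \<le> norm (f - P (2 ^ Suc n) f) + 2 powr (- real n * \<alpha>) * N (P (2 ^ Suc n) f)"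
      by (intro K_functional_le P_in_Y) auto
    also have "2 powr (- real n * \<alpha>) * N (P (2 ^ Suc n) f) = 2 powr \<alpha> * b (Suc n)"
      unfolding shift[of n] b_def by (simp only: mult_ac)
    also have "\<dots> \<le> 2 powr \<alpha> * S powr (1/\<theta>)" using bn by (intro mult_left_mono) auto
    also have "norm (f - P (2 ^ Suc n) f) \<le> M powr (1/\<theta>) * S powr (1/\<theta>)"
      using norm_diff_P_dyadic_decreasing[of f n] error_le_limit_error[of "2 ^ n" f] Dn
      by (simp add: D_def)
    finally show ?thesis by (simp add: distrib_right)
  qed
  show thesis by (rule that[OF _ bound]) (use M in \<open>simp_all add: add_pos_pos\<close>)
qed

text \<open>Identifies the summands of the theorem with powers of the weighted seminorms used
  above.\<close>

lemma dyadic_term_eq: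
  "2 powr (- real k * \<alpha> * p) * N (P (2 ^ k) f) powr p = (2 powr (- real k * \<alpha>) * N (P (2 ^ k) f)) powr p"
  using N_nonneg[OF P_in_Y, of "2 ^ k" f] by (simp add: powr_mult powr_powr)

end

section \<open>From uniform bounds on partial sums to infinite sums\<close>

theorem theorem2p1:
  fixes Y :: "'a::banach set" and N :: "'a \<Rightarrow> real"
    and G :: "nat \<Rightarrow> 'a set" and P :: "nat \<Rightarrow> 'a \<Rightarrow> 'a" and \<alpha> :: real
  assumes "seminorm_on Y N"
    and "approx_family Y G"
    and "best_approximation G P"
    and "\<And>n. n \<ge> 1 \<Longrightarrow> convex (G n)"
    and "\<alpha> > 0"
    and "jackson_inequality Y N G \<alpha>"
    and "bernstein_inequality N G \<alpha>"
    and "realization_inequality Y N G \<alpha>"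
  shows
    "(\<forall>\<tau>>1. uniformly_convex TYPE('a) \<tau> \<longrightarrow>
        (\<exists>C>0. \<forall>f. \<forall>n\<ge>1.
           (\<lambda>k. 2 powr (- real k * \<alpha> * \<tau>) * N (P (2 ^ k) f) powr \<tau>) summable_on {n+1..} \<and>
           (\<Sum>\<^sub>\<infinity>k\<in>{n+1..}. 2 powr (- real k * \<alpha> * \<tau>) * N (P (2 ^ k) f) powr \<tau>) powr (1 / \<tau>)
             \<le> C * K_functional Y N f (2 powr (- real n * \<alpha>)))) \<and>
     (\<forall>\<theta>>1. uniformly_smooth TYPE('a) \<theta> \<longrightarrow>
        (\<exists>C>0. \<forall>f. \<forall>n\<ge>1.
           (\<lambda>k. 2 powr (- real k * \<alpha> * \<theta>) * N (P (2 ^ k) f) powr \<theta>) summable_on {n+1..} \<longrightarrow>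
           K_functional Y N f (2 powr (- real n * \<alpha>))
             \<le> C * (\<Sum>\<^sub>\<infinity>k\<in>{n+1..}. 2 powr (- real k * \<alpha> * \<theta>) * N (P (2 ^ k) f) powr \<theta>) powr (1 / \<theta>)))"
proof -
  interpret approximation_scheme Y N G P \<alpha>
    by unfold_locales (use assms in auto)
  let ?u = "\<lambda>f p k. (2 powr (- real k * \<alpha>) * N (P (2 ^ k) f)) powr p"
  let ?K = "\<lambda>f n. K_functional Y N f (2 powr (- real n * \<alpha>))"
  show ?thesis unfolding dyadic_term_eq Suc_eq_plus1[symmetric]
  proof (intro conjI allI impI)
    fix \<tau> :: real assume \<tau>: "\<tau> > 1" and "uniformly_convex TYPE('a) \<tau>"
    then obtain C where C: "C > 0"
      and sums: "\<And>f n m. (\<Sum>k=Suc n..m. ?u f \<tau> k) \<le> C * ?K f n powr \<tau>"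
      using upper_bound_of_uniformly_convex[OF assms(7,8)] by blast
    have "?u f \<tau> summable_on {Suc n..} \<and>
        (\<Sum>\<^sub>\<infinity>k\<in>{Suc n..}. ?u f \<tau> k) powr (1 / \<tau>) \<le> C powr (1 / \<tau>) * ?K f n" for f n
    proof
      have bound: "infsum (?u f \<tau>) {Suc n..} \<le> C * ?K f n powr \<tau>"
        and "?u f \<tau> summable_on {Suc n..}"
        using nonneg_summable_on_atLeast_bound[of "?u f \<tau>", OF _ sums] by auto
      then show "?u f \<tau> summable_on {Suc n..}" by blast
      have "infsum (?u f \<tau>) {Suc n..} \<ge> 0" by (rule infsum_nonneg) simp
      then have "infsum (?u f \<tau>) {Suc n..} powr (1/\<tau>) \<le> (C * ?K f n powr \<tau>) powr (1/\<tau>)"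
        using bound \<tau> by (intro powr_mono2) auto
      also have "\<dots> = C powr (1/\<tau>) * ?K f n"
        using C \<tau> K_functional_nonneg[of "2 powr (- real n * \<alpha>)" f] by (simp add: powr_mult powr_powr)
      finally show "infsum (?u f \<tau>) {Suc n..} powr (1/\<tau>) \<le> C powr (1/\<tau>) * ?K f n" .
    qed
    then show "\<exists>C>0. \<forall>f. \<forall>n\<ge>1. ?u f \<tau> summable_on {Suc n..} \<and>
        (\<Sum>\<^sub>\<infinity>k\<in>{Suc n..}. ?u f \<tau> k) powr (1 / \<tau>) \<le> C * ?K f n"
      using C by (intro exI[of _ "C powr (1/\<tau>)"]) simp
  next
    fix \<theta> :: real assume \<theta>: "\<theta> > 1" and "uniformly_smooth TYPE('a) \<theta>"
    then obtain C where C: "C > 0"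
      and bound: "\<And>f n S. (\<And>m. (\<Sum>k=Suc n..m. ?u f \<theta> k) \<le> S) \<Longrightarrow> ?K f n \<le> C * S powr (1 / \<theta>)"
      using lower_bound_of_uniformly_smooth[OF assms(6)] by blast
    have "?K f n \<le> C * (\<Sum>\<^sub>\<infinity>k\<in>{Suc n..}. ?u f \<theta> k) powr (1 / \<theta>)"
      if "?u f \<theta> summable_on {Suc n..}" for f n
      by (rule bound, rule finite_sum_le_infsum[OF that]) auto
    then show "\<exists>C>0. \<forall>f. \<forall>n\<ge>1. ?u f \<theta> summable_on {Suc n..} \<longrightarrow>
        ?K f n \<le> C * (\<Sum>\<^sub>\<infinity>k\<in>{Suc n..}. ?u f \<theta> k) powr (1 / \<theta>)"
      using C by blast
  qed
qed

end
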